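(* In any dimension $d\ge2$, there exists a discrete subgroup $\Gamma<\mathrm{SL}(\mathbb{R}^{d+1})$ dividing a proper convex cone $\mathcal{C}\subset\mathbb{R}^{d+1}$ over a proper convex domain $\Omega\subset\mathbb{P}(\mathbb{R}^{d+1})$ which is not projectively equivalent to an ellipse (giving the Klein ball model of the hyperbolic space).
   Context: A convex cone in $\mathbb{R}^{d+1}$ is proper if it is non-empty and its closure contains no entire line. A proper convex domain of $\mathbb{P}(\mathbb{R}^{d+1})$ is a non-empty open convex domain that is bounded in some affine chart. A discrete torsion-free subgroup $\Gamma<\mathrm{SL}(\mathbb{R}^{d+1})$ divides an open proper convex cone $\mathcal{C}$ if $\Gamma$ preserves $\mathcal{C}$ and the induced projective action of $\Gamma$ on the projectivisation $\Omega=\mathbb{P}(\mathcal{C})$ is properly discontinuous and cocompact. Here "ellipse" means an ellipsoid of dimension $d$, i.e. the projective ball that gives the Klein model of $d$-dimensional hyperbolic space. *)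

theory Defs
  imports "HOL-Analysis.Analysis" "HOL-Algebra.Group"
begin

definition special_linear :: "(real^'n^'n) monoid" where
  "special_linear = \<lparr>carrier = {A. det A = 1}, monoid.mult = (**), one = mat 1\<rparr>"

lemma group_special_linear: "group (special_linear :: (real^'n^'n) monoid)"
proof (rule groupI)
  fix A :: "real^'n^'n"
  assume A: "A \<in> carrier special_linear"
  then have det: "det A = 1" by (simp add: special_linear_def)
  then have "invertible A" by (simp add: invertible_det_nz)
  then obtain B where B: "A ** B = mat 1" "B ** A = mat 1"
    by (auto simp: invertible_def)
  have "det B = 1"
    using det_mul[of A B] B det by simp
  with B show "\<exists>B\<in>carrier special_linear. B \<otimes>\<^bsub>special_linear\<^esub> A = \<one>\<^bsub>special_linear\<^esub>"
    by (auto simp: special_linear_def)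
qed (auto simp: special_linear_def det_mul matrix_mul_assoc)

definition torsion_free :: "('a, 'b) monoid_scheme \<Rightarrow> 'a set \<Rightarrow> bool" where
  "torsion_free G H \<longleftrightarrow>
     (\<forall>x\<in>H. \<forall>k::nat. k > 0 \<longrightarrow> x [^]\<^bsub>G\<^esub> k = \<one>\<^bsub>G\<^esub> \<longrightarrow> x = \<one>\<^bsub>G\<^esub>)"

definition quotient_top :: "'a topology \<Rightarrow> ('a \<Rightarrow> 'b) \<Rightarrow> 'b topology" where
  "quotient_top X f =
     topology (\<lambda>U. U \<subseteq> f ` topspace X \<and> openin X {x \<in> topspace X. f x \<in> U})"

lemma openin_quotient_top:
  "openin (quotient_top X f) U \<longleftrightarrow>
     U \<subseteq> f ` topspace X \<and> openin X {x \<in> topspace X. f x \<in> U}"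
proof -
  have "istopology (\<lambda>U. U \<subseteq> f ` topspace X \<and> openin X {x \<in> topspace X. f x \<in> U})"
    unfolding istopology_def
  proof (intro conjI allI impI)
    fix S T
    assume "S \<subseteq> f ` topspace X \<and> openin X {x \<in> topspace X. f x \<in> S}"
      and "T \<subseteq> f ` topspace X \<and> openin X {x \<in> topspace X. f x \<in> T}"
    moreover have "{x \<in> topspace X. f x \<in> S \<inter> T} =
        {x \<in> topspace X. f x \<in> S} \<inter> {x \<in> topspace X. f x \<in> T}" by auto
    ultimately show "openin X {x \<in> topspace X. f x \<in> S \<inter> T}" by auto
  next
    fix \<K>
    assume "\<forall>K\<in>\<K>. K \<subseteq> f ` topspace X \<and> openin X {x \<in> topspace X. f x \<in> K}"
    moreover have "{x \<in> topspace X. f x \<in> \<Union>\<K>} = (\<Union>K\<in>\<K>. {x \<in> topspace X. f x \<in> K})"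
      by auto
    ultimately show "openin X {x \<in> topspace X. f x \<in> \<Union>\<K>}" by auto
  qed auto
  then show ?thesis by (simp add: quotient_top_def)
qed

text \<open>A point of the projective space is a line through the origin, \<^term>\<open>span {v}\<close> with
  \<^prop>\<open>v \<noteq> 0\<close>, regarded as a set of vectors.\<close>

definition proj_top :: "(real^'n) set topology" where
  "proj_top = quotient_top (top_of_set (- {0})) (\<lambda>v. span {v})"

definition projectivisation :: "(real^'n) set \<Rightarrow> (real^'n) set set" where
  "projectivisation C = (\<lambda>v. span {v}) ` C"

definition proj_act :: "real^'n^'n \<Rightarrow> (real^'n) set \<Rightarrow> (real^'n) set" where
  "proj_act A L = (\<lambda>v. A *v v) ` L"

definition projectively_equivalent :: "(real^'n) set set \<Rightarrow> (real^'n) set set \<Rightarrow> bool" where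
  "projectively_equivalent \<Omega> \<Omega>' \<longleftrightarrow>
     (\<exists>A::real^'n^'n. invertible A \<and> proj_act A ` \<Omega> = \<Omega>')"

text \<open>The cones here are stable under positive scaling only: the library predicates
  \<^const>\<open>cone\<close>, \<^const>\<open>conic\<close> and \<^const>\<open>convex_cone\<close> also scale by zero, which no
  open cone other than the whole space (or the empty set) allows.\<close>

definition proper_convex_cone :: "(real^'n) set \<Rightarrow> bool" where
  "proper_convex_cone C \<longleftrightarrow>
     convex C \<and> (\<forall>v\<in>C. \<forall>c>0. c *\<^sub>R v \<in> C) \<and> C \<noteq> {} \<and>
     \<not> (\<exists>p v. v \<noteq> 0 \<and> range (\<lambda>t::real. p + t *\<^sub>R v) \<subseteq> closure C)"

text \<open>The affine chart attached to \<^term>\<open>a \<noteq> 0\<close> consists of the lines not orthogonal to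
  \<^term>\<open>a\<close>; it is identified with the affine hyperplane \<^term>\<open>{v. a \<bullet> v = 1}\<close>.\<close>

definition affine_chart :: "real^'n \<Rightarrow> (real^'n) set set" where
  "affine_chart a = {span {v} | v. a \<bullet> v \<noteq> 0}"

definition proper_convex_domain :: "(real^'n) set set \<Rightarrow> bool" where
  "proper_convex_domain \<Omega> \<longleftrightarrow>
     \<Omega> \<noteq> {} \<and> openin proj_top \<Omega> \<and>
     (\<exists>a. a \<noteq> 0 \<and> \<Omega> \<subseteq> affine_chart a \<and>
        convex {v. a \<bullet> v = 1 \<and> span {v} \<in> \<Omega>} \<and>
        bounded {v. a \<bullet> v = 1 \<and> span {v} \<in> \<Omega>})"

definition properly_discontinuous :: "(real^'n^'n) set \<Rightarrow> (real^'n) set set \<Rightarrow> bool" where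
  "properly_discontinuous \<Gamma> \<Omega> \<longleftrightarrow>
     (\<forall>K. compactin proj_top K \<and> K \<subseteq> \<Omega> \<longrightarrow>
        finite {A \<in> \<Gamma>. proj_act A ` K \<inter> K \<noteq> {}})"

definition cocompact :: "(real^'n^'n) set \<Rightarrow> (real^'n) set set \<Rightarrow> bool" where
  "cocompact \<Gamma> \<Omega> \<longleftrightarrow>
     compact_space (quotient_top (subtopology proj_top \<Omega>) (\<lambda>L. (\<lambda>A. proj_act A L) ` \<Gamma>))"

definition divides :: "(real^'n^'n) set \<Rightarrow> (real^'n) set \<Rightarrow> bool" where
  "divides \<Gamma> C \<longleftrightarrow>
     subgroup \<Gamma> special_linear \<and> discrete \<Gamma> \<and> torsion_free special_linear \<Gamma> \<and>
     open C \<and> proper_convex_cone C \<and>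
     (\<forall>A\<in>\<Gamma>. (\<lambda>v. A *v v) ` C = C) \<and>
     properly_discontinuous \<Gamma> (projectivisation C) \<and> cocompact \<Gamma> (projectivisation C)"

text \<open>The Klein ball: the open unit ball centred at the \<^term>\<open>i\<close>-th basis vector in the
  affine chart \<^term>\<open>v$i = 1\<close>. As the index type carries no order, the distinguished
  coordinate \<^term>\<open>i\<close> is a parameter; different choices differ by a permutation of the
  coordinates.\<close>

definition klein_ball :: "'n \<Rightarrow> (real^'n) set set" where
  "klein_ball i = {span {v} | v. v $ i = 1 \<and> (\<Sum>j\<in>UNIV - {i}. (v $ j)\<^sup>2) < 1}"

definition proj_ellipse :: "(real^'n) set set \<Rightarrow> bool" where
  "proj_ellipse \<Omega> \<longleftrightarrow> (\<exists>i. projectively_equivalent \<Omega> (klein_ball i))"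

end

theory Submission
  imports Defs
begin

text \<open>The domain is an open simplex, the projectivisation of the open positive orthant. It is
  divided by the diagonal matrices with entries \<open>exp (z i)\<close> for integer vectors \<open>z\<close> of sum
  zero: in logarithmic coordinates they act as a lattice of translations on
  \<open>\<real>\<^sup>n / \<real>(1,\<dots>,1)\<close>. The simplex is not an ellipsoid because a quadratic form
  vanishing on the boundary of the orthant vanishes identically in dimension at least three.\<close>

section \<open>Lines and the topology of projective space\<close>

lemma span_singleton_scaleR:
  fixes v :: "'a::real_vector"
  assumes "c \<noteq> 0"
  shows "span {c *\<^sub>R v} = span {v}"
  using span_image_scale[of "{v}" "\<lambda>_. c"] assms by simp

lemma span_singleton_eqD:
  fixes v w :: "'a::real_vector"
  assumes "span {v} = span {w}" "v \<noteq> 0"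
  obtains c where "c \<noteq> 0" "v = c *\<^sub>R w"
proof -
  have "v \<in> span {w}"
    using assms(1) span_base[of v "{v}"] by simp
  then obtain c where "v = c *\<^sub>R w"
    by (auto simp: span_singleton)
  with assms(2) show thesis
    by (intro that[of c]) auto
qed

lemma proj_act_span: "proj_act A (span {v}) = span {A *v v}"
  using linear_span_image[OF matrix_vector_mul_linear, of A "{v}"] by (simp add: proj_act_def)

lemma topspace_quotient_top [simp]: "topspace (quotient_top X f) = f ` topspace X"
proof
  show "topspace (quotient_top X f) \<subseteq> f ` topspace X"
    using openin_topspace[of "quotient_top X f"] by (simp only: openin_quotient_top)
  have "{x \<in> topspace X. f x \<in> f ` topspace X} = topspace X"
    by auto
  then have "openin (quotient_top X f) (f ` topspace X)"
    by (simp add: openin_quotient_top)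
  then show "f ` topspace X \<subseteq> topspace (quotient_top X f)"
    by (rule openin_subset)
qed

lemma continuous_map_quotient_top: "continuous_map X (quotient_top X f) f"
  by (auto simp: continuous_map_def openin_quotient_top)

section \<open>Membership and openness for projectivised cones\<close>

text \<open>Generators of one line differ by a nonzero factor. Its absolute value is absorbed by
  positive scaling, so only its sign remains undetermined.\<close>

lemma span_in_projectivisation_iff:
  assumes "\<And>v c. v \<in> S \<Longrightarrow> c > 0 \<Longrightarrow> c *\<^sub>R v \<in> S" "v \<noteq> 0"
  shows "span {v} \<in> projectivisation S \<longleftrightarrow> v \<in> S \<or> - v \<in> S"
proof
  assume "span {v} \<in> projectivisation S"
  then obtain w where w: "w \<in> S" "span {v} = span {w}"
    by (auto simp: projectivisation_def)
  then obtain c where c: "c \<noteq> 0" "v = c *\<^sub>R w"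
    using span_singleton_eqD[OF w(2) assms(2)] by blast
  show "v \<in> S \<or> - v \<in> S"
  proof (cases "c > 0")
    case True
    then show ?thesis using assms(1)[OF w(1)] c by simp
  next
    case False
    then show ?thesis using assms(1)[OF w(1), of "- c"] c by simp
  qed
next
  have "span {- v} = span {v}"
    using span_singleton_scaleR[of "-1" v] by simp
  moreover assume "v \<in> S \<or> - v \<in> S"
  ultimately show "span {v} \<in> projectivisation S"
    unfolding projectivisation_def by (metis image_eqI)
qed

text \<open>The preimage under \<open>span\<close> in the punctured space is the double cone formed
  by \<open>S\<close> and its negative, which is open.\<close>

lemma openin_proj_top_projectivisation:
  fixes S :: "(real^'n) set"
  assumes "open S" "0 \<notin> S" "\<And>v c. v \<in> S \<Longrightarrow> c > 0 \<Longrightarrow> c *\<^sub>R v \<in> S"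
  shows "openin proj_top (projectivisation S)"
proof -
  have "{v \<in> - {0}. span {v} \<in> projectivisation S} = S \<union> uminus ` S"
  proof (rule Set.set_eqI)
    fix v
    have "v \<in> uminus ` S \<longleftrightarrow> - v \<in> S"
      by (metis add.inverse_inverse image_iff)
    then show "v \<in> {v \<in> - {0}. span {v} \<in> projectivisation S} \<longleftrightarrow> v \<in> S \<union> uminus ` S"
      using span_in_projectivisation_iff[OF assms(3), of v] assms(2)
      by (cases "v = 0") auto
  qed
  moreover have "openin (top_of_set (- {0})) (S \<union> uminus ` S)"
    using assms(1,2) open_negations[of S] by (intro open_subset) auto
  moreover have "projectivisation S \<subseteq> (\<lambda>v. span {v}) ` (- {0})"
    using assms(2) by (auto simp: projectivisation_def)
  ultimately show ?thesis
    by (simp add: proj_top_def openin_quotient_top)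
qed

section \<open>The positive orthant\<close>

definition pos_orthant :: "(real^'n) set" where
  "pos_orthant = {v. \<forall>i. v $ i > 0}"

lemma pos_orthant_scaleR: "v \<in> pos_orthant \<Longrightarrow> c > 0 \<Longrightarrow> c *\<^sub>R v \<in> pos_orthant"
  by (simp add: pos_orthant_def)

lemma zero_notin_pos_orthant: "0 \<notin> pos_orthant"
  by (simp add: pos_orthant_def)

lemma one_in_pos_orthant: "1 \<in> pos_orthant"
  by (simp add: pos_orthant_def)

lemma pos_orthant_halfspaces: "pos_orthant = (\<Inter>i. {v :: real^'n. axis i 1 \<bullet> v > 0})"
  by (auto simp: pos_orthant_def inner_axis')

lemma open_pos_orthant: "open (pos_orthant :: (real^'n) set)"
  unfolding pos_orthant_halfspaces by (intro open_INT ballI open_halfspace_gt) simp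

lemma convex_pos_orthant: "convex (pos_orthant :: (real^'n) set)"
  unfolding pos_orthant_halfspaces by (intro convex_INT convex_halfspace_gt)

lemma proper_convex_cone_pos_orthant: "proper_convex_cone (pos_orthant :: (real^'n) set)"
  unfolding proper_convex_cone_def
proof (intro conjI notI)
  assume "\<exists>p v. v \<noteq> 0 \<and> range (\<lambda>t::real. p + t *\<^sub>R v) \<subseteq> closure (pos_orthant :: (real^'n) set)"
  then obtain p v :: "real^'n" where v: "v \<noteq> 0"
    and *: "\<And>t::real. p + t *\<^sub>R v \<in> closure pos_orthant"
    by blast
  have closed: "closed {v :: real^'n. \<forall>i. 0 \<le> v $ i}"
    by (intro closed_Collect_all closed_Collect_le continuous_intros)
  have "closure pos_orthant \<subseteq> {v :: real^'n. \<forall>i. 0 \<le> v $ i}"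
    by (rule closure_minimal[OF _ closed]) (auto simp: pos_orthant_def less_imp_le)
  with * have nonneg: "0 \<le> p $ i + t * v $ i" for i t
    by force
  from v obtain i where "v $ i \<noteq> 0"
    by (auto simp: vec_eq_iff)
  then show False
    \<comment> \<open>This parameter brings the \<open>i\<close>-th coordinate of the line to
      -1.\<close>
    using nonneg[of i "- (p $ i + 1) / v $ i"] by simp
qed (use one_in_pos_orthant in \<open>auto simp: convex_pos_orthant pos_orthant_scaleR\<close>)

text \<open>The chart attached to the all-ones vector normalises the coordinate sum to 1. In it the
  domain is the open standard simplex, which lies in the unit cube.\<close>

lemma proper_convex_domain_pos_orthant:
  "proper_convex_domain (projectivisation (pos_orthant :: (real^'n) set))"
  unfolding proper_convex_domain_def
proof (intro conjI exI[of _ "1 :: real^'n"])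
  let ?C = "pos_orthant :: (real^'n) set"
  have inner_one: "1 \<bullet> v = (\<Sum>i\<in>UNIV. v $ i)" for v :: "real^'n"
    by (simp add: inner_vec_def)
  have sum_pos: "0 < (\<Sum>i\<in>UNIV. v $ i)" if "v \<in> ?C" for v
    using that by (intro sum_pos) (auto simp: pos_orthant_def)
  show "projectivisation ?C \<noteq> {}"
    using one_in_pos_orthant by (auto simp: projectivisation_def)
  show "openin proj_top (projectivisation ?C)"
    by (intro openin_proj_top_projectivisation open_pos_orthant zero_notin_pos_orthant
        pos_orthant_scaleR)
  show "(1 :: real^'n) \<noteq> 0"
    by (simp add: vec_eq_iff)
  show "projectivisation ?C \<subseteq> affine_chart 1"
    using sum_pos by (fastforce simp: projectivisation_def affine_chart_def inner_one)
  \<comment> \<open>A vector with coordinate sum 1 cannot have its negative in the orthant, so the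
    sign ambiguity disappears.\<close>
  have slice: "{v. 1 \<bullet> v = 1 \<and> span {v} \<in> projectivisation ?C} = {v. 1 \<bullet> v = 1} \<inter> ?C"
  proof -
    have "span {v} \<in> projectivisation ?C \<longleftrightarrow> v \<in> ?C" if "1 \<bullet> v = 1" for v
    proof -
      have "v \<noteq> 0" "- v \<notin> ?C"
        using that sum_pos[of "- v"] by (auto simp: inner_one sum_negf)
      then show ?thesis
        using span_in_projectivisation_iff[OF pos_orthant_scaleR] by blast
    qed
    then show ?thesis by blast
  qed
  show "convex {v. 1 \<bullet> v = 1 \<and> span {v} \<in> projectivisation ?C}"
    unfolding slice by (intro convex_Int convex_hyperplane convex_pos_orthant)
  have "v \<in> cbox 0 1" if "1 \<bullet> v = 1" "v \<in> ?C" for v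
  proof -
    have "v $ i \<le> (\<Sum>i\<in>UNIV. v $ i)" for i
      using that(2) by (intro member_le_sum) (auto simp: pos_orthant_def less_imp_le)
    then show ?thesis
      using that by (auto simp: mem_box_cart inner_one pos_orthant_def less_imp_le)
  qed
  then show "bounded {v. 1 \<bullet> v = 1 \<and> span {v} \<in> projectivisation ?C}"
    unfolding slice by (intro bounded_subset[OF bounded_cbox[of 0 1]]) auto
qed

section \<open>The lattice of diagonal matrices\<close>

definition exp_diag :: "('n \<Rightarrow> int) \<Rightarrow> real^'n^'n" where
  "exp_diag z = (\<chi> i j. if i = j then exp (of_int (z i)) else 0)"

text \<open>Sum zero gives determinant one. It also excludes the nontrivial scalar matrices, which
  would act trivially on lines.\<close>

definition diag_lattice :: "(real^'n^'n) set" where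
  "diag_lattice = exp_diag ` {z. sum z UNIV = 0}"

lemma exp_diag_vector: "exp_diag z *v v = (\<chi> i. exp (of_int (z i)) * v $ i)"
  by (simp add: exp_diag_def matrix_vector_mult_def vec_eq_iff if_distrib[of "\<lambda>x. x * _"]
      cong: if_cong)

lemma exp_diag_mult: "exp_diag z ** exp_diag w = exp_diag (\<lambda>i. z i + w i)"
  by (simp add: exp_diag_def matrix_matrix_mult_def vec_eq_iff exp_add
      if_distrib[of "\<lambda>x. x * _"] cong: if_cong)

lemma exp_diag_zero: "exp_diag (\<lambda>_. 0) = mat 1"
  by (simp add: exp_diag_def mat_def cong: if_cong)

lemma inj_exp_diag: "inj exp_diag"
proof (rule injI, rule ext)
  fix z w :: "'n::finite \<Rightarrow> int" and i
  assume "exp_diag z = exp_diag w"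
  then have "exp_diag z $ i $ i = exp_diag w $ i $ i" by simp
  then show "z i = w i" by (simp add: exp_diag_def)
qed

lemma det_exp_diag: "det (exp_diag z) = exp (of_int (sum z UNIV))"
  by (simp add: exp_diag_def det_diagonal exp_sum)

section \<open>Subgroup, discreteness and absence of torsion\<close>

lemma subgroup_diag_lattice: "subgroup (diag_lattice :: (real^'n^'n) set) special_linear"
proof (rule group.subgroupI[OF group_special_linear])
  show sub: "diag_lattice \<subseteq> carrier special_linear"
    by (auto simp: diag_lattice_def special_linear_def det_exp_diag)
  show "(diag_lattice :: (real^'n^'n) set) \<noteq> {}"
    by (auto simp: diag_lattice_def intro: exI[of _ "\<lambda>_. 0"])
  fix A B :: "real^'n^'n"
  assume A: "A \<in> diag_lattice"
  then obtain z where z: "A = exp_diag z" "sum z UNIV = 0"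
    by (auto simp: diag_lattice_def)
  have minus: "exp_diag (\<lambda>i. - z i) \<in> diag_lattice"
    using z by (auto simp: diag_lattice_def sum_negf)
  have "inv\<^bsub>special_linear\<^esub> A = exp_diag (\<lambda>i. - z i)"
    using A sub minus
    by (intro group.inv_equality[OF group_special_linear])
       (auto simp: z special_linear_def exp_diag_mult exp_diag_zero)
  with minus show "inv\<^bsub>special_linear\<^esub> A \<in> diag_lattice" by simp
  assume "B \<in> diag_lattice"
  then obtain w where w: "B = exp_diag w" "sum w UNIV = 0"
    by (auto simp: diag_lattice_def)
  show "A \<otimes>\<^bsub>special_linear\<^esub> B \<in> diag_lattice"
    using z w by (auto simp: special_linear_def exp_diag_mult diag_lattice_def sum.distrib)
qed

lemma discrete_diag_lattice: "discrete (diag_lattice :: (real^'n^'n) set)"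
proof (rule discreteI)
  fix A :: "real^'n^'n"
  assume A: "A \<in> diag_lattice"
  then obtain z where z: "A = exp_diag z"
    by (auto simp: diag_lattice_def)
  \<comment> \<open>The logarithm of each diagonal entry is confined to an open interval of radius 1
    about \<open>z i\<close>, which contains no other integer.\<close>
  define T where "T = (\<Inter>i. {B :: real^'n^'n. exp (of_int (z i) - 1) < B $ i $ i}
    \<inter> {B. B $ i $ i < exp (of_int (z i) + 1)})"
  have "open T"
    unfolding T_def by (auto intro!: open_INT open_Int open_Collect_less continuous_intros)
  have T_iff: "exp_diag w \<in> T \<longleftrightarrow> w = z" for w
  proof
    assume "exp_diag w \<in> T"
    then have near: "real_of_int (z i) - 1 < real_of_int (w i) \<and>
        real_of_int (w i) < real_of_int (z i) + 1" for i
      by (auto simp: T_def exp_diag_def)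
    have "w i = z i" for i
      using near[of i] by linarith
    then show "w = z" by blast
  qed (auto simp: T_def exp_diag_def)
  have "T \<inter> diag_lattice = {A}"
    using A by (auto simp: diag_lattice_def z T_iff inj_eq[OF inj_exp_diag])
  with \<open>open T\<close> show "A isolated_in diag_lattice"
    using A by (auto simp: isolated_in_def)
qed

text \<open>Taking the \<open>k\<close>-th power multiplies the exponent vector by \<open>k\<close>,
  and the group of integer vectors has no torsion.\<close>

lemma torsion_free_diag_lattice: "torsion_free special_linear (diag_lattice :: (real^'n^'n) set)"
  unfolding torsion_free_def
proof (intro ballI allI impI)
  fix A :: "real^'n^'n" and k :: nat
  assume "A \<in> diag_lattice" and k: "k > 0"
    and 1: "A [^]\<^bsub>special_linear\<^esub> k = \<one>\<^bsub>special_linear\<^esub>"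
  then obtain z where z: "A = exp_diag z"
    by (auto simp: diag_lattice_def)
  have "A [^]\<^bsub>special_linear\<^esub> m = exp_diag (\<lambda>i. int m * z i)" for m :: nat
  proof (induction m)
    case 0
    then show ?case by (simp add: special_linear_def exp_diag_zero)
  next
    case (Suc m)
    have "A [^]\<^bsub>special_linear\<^esub> Suc m = A [^]\<^bsub>special_linear\<^esub> m ** A"
      by (simp add: nat_pow_Suc special_linear_def)
    then show ?case
      unfolding Suc.IH by (simp add: z exp_diag_mult algebra_simps)
  qed
  with 1 have "exp_diag (\<lambda>i. int k * z i) = exp_diag (\<lambda>_. 0)"
    by (simp add: exp_diag_zero special_linear_def)
  then have "z = (\<lambda>_. 0)"
    using k by (auto simp: inj_eq[OF inj_exp_diag] fun_eq_iff)
  then show "A = \<one>\<^bsub>special_linear\<^esub>"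
    by (simp add: z exp_diag_zero special_linear_def)
qed

section \<open>The action on the orthant and the simplex\<close>

lemma exp_diag_pos_orthant: "v \<in> pos_orthant \<Longrightarrow> exp_diag z *v v \<in> pos_orthant"
  by (simp add: pos_orthant_def exp_diag_vector)

lemma exp_diag_image_pos_orthant:
  fixes z :: "'n::finite \<Rightarrow> int"
  shows "(\<lambda>v. exp_diag z *v v) ` pos_orthant = pos_orthant"
proof
  show "pos_orthant \<subseteq> (\<lambda>v. exp_diag z *v v) ` pos_orthant"
  proof
    fix v :: "real^'n"
    assume "v \<in> pos_orthant"
    then have "exp_diag (\<lambda>i. - z i) *v v \<in> pos_orthant"
      by (rule exp_diag_pos_orthant)
    moreover have "v = exp_diag z *v (exp_diag (\<lambda>i. - z i) *v v)"
      by (simp add: matrix_vector_mul_assoc exp_diag_mult exp_diag_zero)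
    ultimately show "v \<in> (\<lambda>v. exp_diag z *v v) ` pos_orthant" by blast
  qed
qed (auto intro: exp_diag_pos_orthant)

text \<open>A compact \<open>K\<close> lies in a region where all quotients of two coordinates are
  bounded. An element returning a point of that region to it has bounded differences of exponents,
  and sum zero then bounds the exponents themselves.\<close>

lemma properly_discontinuous_diag_lattice:
  "properly_discontinuous diag_lattice (projectivisation (pos_orthant :: (real^'n) set))"
  unfolding properly_discontinuous_def
proof (intro allI impI)
  fix K :: "(real^'n) set set"
  assume K: "compactin proj_top K \<and> K \<subseteq> projectivisation pos_orthant"
  \<comment> \<open>An increasing exhaustion of the orthant by open cones: on \<open>P m\<close>
    every quotient of two coordinates is below \<open>exp m\<close>. The condition is scale
    invariant, so it descends to lines.\<close>
  define P where "P m = {v :: real^'n. v \<in> pos_orthant \<and> (\<forall>i j. v $ i < exp (real m) * v $ j)}"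
    for m :: nat
  have P_scale: "c *\<^sub>R v \<in> P m" if "v \<in> P m" "c > 0" for c v m
    using that by (auto simp: P_def pos_orthant_scaleR mult.left_commute)
  have P_mono: "P m \<subseteq> P m'" if "m \<le> m'" for m m'
  proof
    fix v assume v: "v \<in> P m"
    have "exp (real m) * v $ j \<le> exp (real m') * v $ j" for j
      using v that by (intro mult_right_mono) (auto simp: P_def pos_orthant_def less_imp_le)
    then show "v \<in> P m'"
      using v by (auto simp: P_def intro: less_le_trans)
  qed
  have P_open: "openin proj_top (projectivisation (P m))" for m
  proof (rule openin_proj_top_projectivisation)
    have "P m = pos_orthant \<inter> (\<Inter>i. \<Inter>j. {v. v $ i < exp (real m) * v $ j})"
      by (auto simp: P_def)
    then show "open (P m)"
      by (auto intro!: open_pos_orthant open_Int open_INT open_Collect_less continuous_intros)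
  qed (auto simp: P_scale, simp add: P_def zero_notin_pos_orthant)
  have "pos_orthant \<subseteq> (\<Union>m. P m)"
  proof
    fix v :: "real^'n"
    assume v: "v \<in> pos_orthant"
    \<comment> \<open>Bounding the sum of all the positive quotients bounds each of them at
      once.\<close>
    obtain m :: nat where m: "(\<Sum>i\<in>UNIV. \<Sum>j\<in>UNIV. v $ i / v $ j) < real m"
      using reals_Archimedean2 by blast
    have "v $ i < exp (real m) * v $ j" for i j
    proof -
      have "v $ i / v $ j \<le> (\<Sum>j\<in>UNIV. v $ i / v $ j)"
        using v by (intro member_le_sum) (auto simp: pos_orthant_def less_imp_le)
      also have "\<dots> \<le> (\<Sum>i\<in>UNIV. \<Sum>j\<in>UNIV. v $ i / v $ j)"
        using v by (intro member_le_sum[of i UNIV "\<lambda>i. \<Sum>j\<in>UNIV. v $ i / v $ j"] sum_nonneg)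
          (auto simp: pos_orthant_def less_imp_le)
      also have "\<dots> < real m" by (rule m)
      also have "\<dots> \<le> exp (real m)"
        using exp_ge_add_one_self[of "real m"] by linarith
      finally show ?thesis
        using v by (simp add: pos_orthant_def pos_divide_less_eq)
    qed
    with v show "v \<in> (\<Union>m. P m)" by (auto simp: P_def)
  qed
  then have "K \<subseteq> \<Union> (range (\<lambda>m. projectivisation (P m)))"
    using K unfolding projectivisation_def by fastforce
  then obtain \<F> where \<F>: "finite \<F>" "\<F> \<subseteq> range (\<lambda>m. projectivisation (P m))" "K \<subseteq> \<Union>\<F>"
    using K P_open unfolding compactin_def
    by (metis (no_types, lifting) imageE)
  obtain M where M: "finite M" "\<F> = (\<lambda>m. projectivisation (P m)) ` M"
    using finite_subset_image[OF \<F>(1,2)] by blast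
  obtain m where m: "\<forall>k\<in>M. k \<le> m"
    using M(1) finite_nat_set_iff_bounded_le by blast
  have KP: "K \<subseteq> projectivisation (P m)"
    using \<F>(3) M(2) m P_mono unfolding projectivisation_def by blast
  define Z where "Z = {z :: 'n \<Rightarrow> int. \<forall>i. z i \<in> {- 2 * int m..2 * int m}}"
  have "finite Z"
    using finite_set_of_finite_funs[of "UNIV :: 'n set" "{- 2 * int m..2 * int m}"]
    by (simp add: Z_def)
  moreover have "{A \<in> diag_lattice. proj_act A ` K \<inter> K \<noteq> {}} \<subseteq> exp_diag ` Z"
  proof
    fix A :: "real^'n^'n"
    assume "A \<in> {A \<in> diag_lattice. proj_act A ` K \<inter> K \<noteq> {}}"
    then obtain z L where z: "A = exp_diag z" "sum z UNIV = 0" and L: "L \<in> K" "proj_act A L \<in> K"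
      by (auto simp: diag_lattice_def)
    obtain v where v: "v \<in> P m" "L = span {v}"
      using L(1) KP by (auto simp: projectivisation_def)
    define w where "w = A *v v"
    have w_pos: "w \<in> pos_orthant"
      using v by (simp add: w_def z P_def exp_diag_pos_orthant)
    \<comment> \<open>The line of \<open>w\<close> determines \<open>w\<close> only up to sign;
      positivity of \<open>w\<close> rules out the other sign.\<close>
    then have "w \<noteq> 0" "- w \<notin> pos_orthant"
      using zero_notin_pos_orthant by (auto simp: pos_orthant_def) (metis less_asym)
    moreover have "span {w} \<in> projectivisation (P m)"
      using L(2) KP by (auto simp: v w_def proj_act_span)
    ultimately have w: "w \<in> P m"
      using span_in_projectivisation_iff[of "P m" w, OF P_scale] by (auto simp: P_def)
    \<comment> \<open>One factor \<open>exp m\<close> comes from comparing coordinates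
      \<open>i\<close> and \<open>j\<close> of \<open>w\<close>, the other from comparing
      \<open>j\<close> and \<open>i\<close> of \<open>v\<close>; together they give
      \<open>2 * m\<close>.\<close>
    have diff: "z i - z j \<le> 2 * int m" for i j
    proof -
      have pos: "0 < v $ i" "0 < v $ j"
        using v by (auto simp: P_def pos_orthant_def)
      have "exp (z i) * v $ i < exp (real m) * (exp (z j) * v $ j)"
        using w by (auto simp: w_def z exp_diag_vector P_def)
      also have "\<dots> < exp (real m) * (exp (z j) * (exp (real m) * v $ i))"
        using v by (auto simp: P_def)
      finally have "exp (z i) < exp (real m) * (exp (z j) * exp (real m))"
        using pos by (simp add: mult.assoc[symmetric])
      then have "exp (z i) < exp (real m + z j + real m)"
        by (simp only: exp_add mult_ac)
      then show ?thesis by simp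
    qed
    \<comment> \<open>As \<open>z\<close> has sum zero, \<open>z i\<close> is the average over
      \<open>j\<close> of the differences \<open>z i - z j\<close>, so it inherits their
      bounds.\<close>
    have sums: "(\<Sum>j\<in>UNIV. z i - z j) = int CARD('n) * z i" for i
      using z(2) by (simp add: sum_subtractf)
    have "z i \<in> {- 2 * int m..2 * int m}" for i
    proof -
      have "int CARD('n) * z i \<le> int CARD('n) * (2 * int m)"
        unfolding sums[symmetric] using sum_bounded_above[of UNIV "\<lambda>j. z i - z j"] diff by simp
      moreover have "int CARD('n) * (- 2 * int m) \<le> int CARD('n) * z i"
        unfolding sums[symmetric]
        using sum_bounded_below[of UNIV "- 2 * int m" "\<lambda>j. z i - z j"] diff
        by (simp add: algebra_simps)
      ultimately have "z i \<le> 2 * int m" "- 2 * int m \<le> z i"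
        by (simp_all only: mult_le_cancel_left_pos of_nat_0_less_iff zero_less_card_finite)
      then show ?thesis by simp
    qed
    then show "A \<in> exp_diag ` Z"
      by (auto simp: z Z_def)
  qed
  ultimately show "finite {A \<in> diag_lattice. proj_act A ` K \<inter> K \<noteq> {}}"
    by (meson finite_imageI finite_subset)
qed

text \<open>After normalising the logarithmic coordinates of a point to have sum zero, all but one of
  them can be moved into \<open>[0,1]\<close> by the lattice, which confines the remaining one to
  \<open>[-n,0]\<close>.\<close>

lemma diag_lattice_fundamental_box:
  fixes v :: "real^'n"
  assumes "v \<in> pos_orthant"
  obtains A c where "A \<in> diag_lattice" "c > 0"
    "c *\<^sub>R (A *v v) \<in> cbox (\<chi> i. exp (- real CARD('n))) (\<chi> i. exp 1)"
proof -
  have pos: "v $ i > 0" for i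
    using assms by (simp add: pos_orthant_def)
  \<comment> \<open>The mean of the logarithms; subtracting it amounts to the rescaling by
    \<open>exp (- t)\<close>, which does not change the line.\<close>
  define t where "t = (\<Sum>i\<in>UNIV. ln (v $ i)) / real CARD('n)"
  define x where "x i = ln (v $ i) - t" for i
  have sum_x: "sum x UNIV = 0"
    by (simp add: x_def t_def sum_subtractf)
  \<comment> \<open>An arbitrary coordinate, chosen to absorb the sum of the integer parts removed
    from the others.\<close>
  define k :: 'n where "k = undefined"
  define z where "z i = (if i = k then (\<Sum>j\<in>UNIV-{k}. \<lfloor>x j\<rfloor>) else - \<lfloor>x i\<rfloor>)" for i
  have sum_z: "sum z UNIV = 0"
    by (simp add: sum.remove[of UNIV k] z_def sum_negf)
  have bounds: "- real CARD('n) \<le> x i + z i \<and> x i + z i \<le> 1" for i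
  proof (cases "i = k")
    case True
    have "x k = - (\<Sum>j\<in>UNIV-{k}. x j)"
      using sum_x by (simp add: sum.remove[of UNIV k])
    \<comment> \<open>Coordinate \<open>k\<close> ends up as minus a sum of CARD('n) - 1 fractional
      parts, which yields the lower bound of the box.\<close>
    then have eq: "x k + z k = - (\<Sum>j\<in>UNIV-{k}. frac (x j))"
      by (simp add: z_def frac_def sum_subtractf)
    have "0 \<le> (\<Sum>j\<in>UNIV-{k}. frac (x j))"
      by (intro sum_nonneg) simp
    moreover have "(\<Sum>j\<in>UNIV-{k}. frac (x j)) \<le> (\<Sum>j\<in>UNIV-{k}. 1)"
      by (intro sum_mono) (simp add: frac_lt_1 less_imp_le)
    moreover have "(\<Sum>j\<in>UNIV-{k}. 1 :: real) \<le> real CARD('n)"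
      by (simp add: card_Diff_singleton)
    ultimately have "- real CARD('n) \<le> x k + z k \<and> x k + z k \<le> 1"
      unfolding eq by linarith
    then show ?thesis using True by simp
  next
    case False
    then have "x i + z i = frac (x i)"
      by (simp add: z_def frac_def)
    then show ?thesis
      using frac_ge_0[of "x i"] frac_lt_1[of "x i"] by linarith
  qed
  have coord: "exp (- t) * (exp (z i) * v $ i) = exp (x i + z i)" for i
    using pos[of i] by (simp add: x_def exp_add exp_diff exp_minus field_simps)
  show thesis
  proof (rule that[of "exp_diag z" "exp (- t)"])
    show "exp_diag z \<in> diag_lattice"
      using sum_z by (simp add: diag_lattice_def)
    show "exp (- t) *\<^sub>R (exp_diag z *v v) \<in> cbox (\<chi> i. exp (- real CARD('n))) (\<chi> i. exp 1)"
      using bounds by (simp add: mem_box_cart exp_diag_vector coord)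
  qed simp
qed

text \<open>The compact box of \<open>diag_lattice_fundamental_box\<close> lies in the orthant, and
  its lines meet every orbit. The orbit space is therefore a continuous image of a compact
  set.\<close>

lemma cocompact_diag_lattice:
  "cocompact diag_lattice (projectivisation (pos_orthant :: (real^'n) set))"
proof -
  let ?\<Omega> = "projectivisation (pos_orthant :: (real^'n) set)"
  let ?orb = "\<lambda>L :: (real^'n) set. (\<lambda>A. proj_act A L) ` diag_lattice"
  let ?B = "cbox (\<chi> i. exp (- real CARD('n))) (\<chi> i. exp 1) :: (real^'n) set"
  let ?Q = "quotient_top (subtopology proj_top ?\<Omega>) ?orb"
  have B_pos: "?B \<subseteq> pos_orthant"
    by (auto simp: mem_box_cart pos_orthant_def)
       (meson exp_gt_zero less_le_trans)
  have "?\<Omega> \<subseteq> topspace proj_top"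
    using zero_notin_pos_orthant by (auto simp: projectivisation_def proj_top_def)
  then have top: "topspace ?Q = ?orb ` ?\<Omega>"
    by (simp add: inf_absorb2)
  have "compactin (top_of_set (- {0})) ?B"
    using B_pos zero_notin_pos_orthant by (auto simp: compactin_subtopology)
  then have "compactin proj_top (projectivisation ?B)"
    unfolding projectivisation_def proj_top_def
    by (rule image_compactin[OF _ continuous_map_quotient_top])
  then have "compactin (subtopology proj_top ?\<Omega>) (projectivisation ?B)"
    using B_pos by (auto simp: compactin_subtopology projectivisation_def)
  then have "compactin ?Q (?orb ` projectivisation ?B)"
    by (rule image_compactin[OF _ continuous_map_quotient_top])
  moreover have "?orb ` projectivisation ?B = ?orb ` ?\<Omega>"
  proof
    show "?orb ` ?\<Omega> \<subseteq> ?orb ` projectivisation ?B"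
    proof
      fix X assume "X \<in> ?orb ` ?\<Omega>"
      then obtain v where v: "v \<in> pos_orthant" "X = ?orb (span {v})"
        by (auto simp: projectivisation_def)
      obtain A c where A: "A \<in> diag_lattice" and c: "c > 0" "c *\<^sub>R (A *v v) \<in> ?B"
        using diag_lattice_fundamental_box[OF v(1)] by blast
      obtain z where z: "A = exp_diag z" "sum z UNIV = 0"
        using A by (auto simp: diag_lattice_def)
      let ?L = "span {c *\<^sub>R (A *v v)}"
      have L: "?L = span {A *v v}"
        using c by (simp add: span_singleton_scaleR)
      \<comment> \<open>Translating the exponents by \<open>z\<close> permutes the lattice, so
        moving a point by \<open>A\<close> leaves its orbit unchanged.\<close>
      have "?orb ?L = ?orb (span {v})"
      proof
        show "?orb ?L \<subseteq> ?orb (span {v})"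
        proof
          fix Y assume "Y \<in> ?orb ?L"
          then obtain w where w: "sum w UNIV = 0" "Y = span {exp_diag w *v (A *v v)}"
            by (auto simp: L proj_act_span diag_lattice_def)
          then have "Y = proj_act (exp_diag (\<lambda>i. w i + z i)) (span {v})"
            by (simp add: proj_act_span z matrix_vector_mul_assoc exp_diag_mult)
          moreover have "exp_diag (\<lambda>i. w i + z i) \<in> diag_lattice"
            using w z by (auto simp: diag_lattice_def sum.distrib)
          ultimately show "Y \<in> ?orb (span {v})" by blast
        qed
        show "?orb (span {v}) \<subseteq> ?orb ?L"
        proof
          fix Y assume "Y \<in> ?orb (span {v})"
          then obtain w where w: "sum w UNIV = 0" "Y = span {exp_diag w *v v}"
            by (auto simp: proj_act_span diag_lattice_def)
          then have "Y = proj_act (exp_diag (\<lambda>i. w i - z i)) ?L"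
            unfolding L by (simp add: proj_act_span z matrix_vector_mul_assoc exp_diag_mult)
          moreover have "exp_diag (\<lambda>i. w i - z i) \<in> diag_lattice"
            using w z by (auto simp: diag_lattice_def sum_subtractf)
          ultimately show "Y \<in> ?orb ?L" by blast
        qed
      qed
      moreover have "?L \<in> projectivisation ?B"
        unfolding projectivisation_def using c(2) by (rule imageI)
      ultimately show "X \<in> ?orb ` projectivisation ?B"
        unfolding v(2) by (rule image_eqI[OF sym])
    qed
  qed (use B_pos in \<open>auto simp: projectivisation_def\<close>)
  ultimately show ?thesis
    unfolding cocompact_def compact_space_def top by simp
qed

lemma divides_diag_lattice: "divides diag_lattice (pos_orthant :: (real^'n) set)"
  unfolding divides_def
  using subgroup_diag_lattice discrete_diag_lattice torsion_free_diag_lattice open_pos_orthant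
    proper_convex_cone_pos_orthant properly_discontinuous_diag_lattice cocompact_diag_lattice
  by (auto simp: diag_lattice_def exp_diag_image_pos_orthant)

section \<open>The simplex is not an ellipsoid\<close>

definition lorentz_form :: "'n \<Rightarrow> real^'n \<Rightarrow> real" where
  "lorentz_form i u = (u $ i)\<^sup>2 - (\<Sum>j\<in>UNIV - {i}. (u $ j)\<^sup>2)"

lemma lorentz_form_scaleR: "lorentz_form i (c *\<^sub>R u) = c\<^sup>2 * lorentz_form i u"
  by (simp add: lorentz_form_def power_mult_distrib right_diff_distrib sum_distrib_left)

text \<open>The vanishing of the third difference of a quadratic form: its value on a sum of three
  vectors is determined by its values on the single vectors and the pairwise sums.\<close>

lemma lorentz_form_add3:
  "lorentz_form i (u + v + w) =
    lorentz_form i (u + v) + lorentz_form i (v + w) + lorentz_form i (u + w)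
    - lorentz_form i u - lorentz_form i v - lorentz_form i w"
proof -
  have "(\<Sum>j\<in>UNIV - {i}. ((u + v + w) $ j)\<^sup>2) =
      (\<Sum>j\<in>UNIV - {i}. ((u + v) $ j)\<^sup>2 + ((v + w) $ j)\<^sup>2 + ((u + w) $ j)\<^sup>2
        - (u $ j)\<^sup>2 - (v $ j)\<^sup>2 - (w $ j)\<^sup>2)"
    by (intro sum.cong) (auto simp: power2_eq_square algebra_simps)
  then show ?thesis
    by (simp add: lorentz_form_def sum.distrib sum_subtractf)
       (simp add: power2_eq_square algebra_simps)
qed

text \<open>The form is homogeneous of degree two, so its sign depends only on the line. Positivity
  forces a nonzero \<open>i\<close>-th coordinate, and scaling that coordinate to 1 turns positivity
  into the ball inequality.\<close>

lemma span_in_klein_ball_iff: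
  "span {u} \<in> klein_ball i \<longleftrightarrow> lorentz_form i u > 0"
proof
  assume "span {u} \<in> klein_ball i"
  then obtain v where v: "span {u} = span {v}" "v $ i = 1" "(\<Sum>j\<in>UNIV - {i}. (v $ j)\<^sup>2) < 1"
    by (auto simp: klein_ball_def)
  then have "v \<noteq> 0" by auto
  then obtain c where c: "c \<noteq> 0" "v = c *\<^sub>R u"
    using span_singleton_eqD[of v u] v(1) by metis
  have "0 < lorentz_form i v"
    using v by (simp add: lorentz_form_def)
  with c show "lorentz_form i u > 0"
    by (simp add: lorentz_form_scaleR zero_less_mult_iff)
next
  assume pos: "lorentz_form i u > 0"
  have "0 \<le> (\<Sum>j\<in>UNIV - {i}. (u $ j)\<^sup>2)"
    by (intro sum_nonneg) simp
  then have ui: "u $ i \<noteq> 0"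
    using pos by (auto simp: lorentz_form_def)
  let ?v = "(1 / u $ i) *\<^sub>R u"
  have "0 < lorentz_form i ?v"
    using pos ui unfolding lorentz_form_scaleR by simp
  moreover have "?v $ i = 1" using ui by simp
  moreover have "span {?v} = span {u}"
    using ui by (intro span_singleton_scaleR) simp
  ultimately show "span {u} \<in> klein_ball i"
    unfolding klein_ball_def lorentz_form_def
    by (intro CollectI exI[of _ ?v]) (simp only:, simp)
qed

text \<open>An equivalence with the ball pulls the Lorentz form back to a quadratic form
  \<open>Q\<close> that is positive exactly on the orthant and its negative, hence zero on the
  boundary. Splitting the all-ones vector into three boundary vectors with boundary pairwise sums
  forces \<open>Q 1 = 0\<close>. With only two coordinates the claim fails, since an interval is a
  one-dimensional ball.\<close>

lemma not_proj_ellipse_pos_orthant: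
  assumes "CARD('n) \<ge> 3"
  shows "\<not> proj_ellipse (projectivisation (pos_orthant :: (real^'n) set))"
proof
  assume "proj_ellipse (projectivisation (pos_orthant :: (real^'n) set))"
  then obtain i and A :: "real^'n^'n" where A: "invertible A"
    and image: "proj_act A ` projectivisation pos_orthant = klein_ball i"
    by (auto simp: proj_ellipse_def projectively_equivalent_def)
  have inj: "inj (\<lambda>v. A *v v)"
    using A by (simp add: inj_matrix_vector_mult)
  define Q where "Q v = lorentz_form i (A *v v)" for v
  have Q_pos: "Q v > 0" if "v \<in> pos_orthant" for v
  proof -
    have "span {A *v v} \<in> klein_ball i"
      using that image by (auto simp: projectivisation_def proj_act_span[symmetric])
    then show ?thesis by (simp add: Q_def span_in_klein_ball_iff)
  qed
  have Q_posD: "v \<in> pos_orthant \<or> - v \<in> pos_orthant" if "Q v > 0" for v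
  proof -
    have "A *v v \<noteq> 0"
      using that by (auto simp: Q_def lorentz_form_def)
    have "span {A *v v} \<in> proj_act A ` projectivisation pos_orthant"
      using that by (simp add: image Q_def span_in_klein_ball_iff)
    then have "proj_act A (span {v}) \<in> proj_act A ` projectivisation pos_orthant"
      by (simp add: proj_act_span)
    then have "span {v} \<in> projectivisation pos_orthant"
      using inj unfolding proj_act_def
      by (auto simp: inj_image_eq_iff)
    moreover have "v \<noteq> 0" using \<open>A *v v \<noteq> 0\<close> by auto
    ultimately show ?thesis
      using span_in_projectivisation_iff[OF pos_orthant_scaleR] by blast
  qed
  \<comment> \<open>A zero coordinate keeps \<open>v\<close> out of both orthants, so
    \<open>Q v\<close> is not positive. Conversely, \<open>v\<close> is a limit of orthant points,
    where \<open>Q\<close> is positive.\<close>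
  have Q_boundary: "Q v = 0" if nonneg: "\<And>j. v $ j \<ge> 0" and zero: "v $ k = 0" for v k
  proof (rule antisym)
    have "v \<notin> pos_orthant" "- v \<notin> pos_orthant"
      using zero by (auto simp: pos_orthant_def intro: exI[of _ k])
    then show "Q v \<le> 0" using Q_posD[of v] by force
    have "(\<lambda>m. v + inverse (real (Suc m)) *\<^sub>R 1) \<longlonglongrightarrow> v + 0 *\<^sub>R 1"
      by (intro tendsto_intros LIMSEQ_inverse_real_of_nat)
    moreover have "continuous_on UNIV Q"
      unfolding Q_def lorentz_form_def
      by (intro continuous_intros matrix_vector_mult_linear_continuous_on)
    ultimately have "(\<lambda>m. Q (v + inverse (real (Suc m)) *\<^sub>R 1)) \<longlonglongrightarrow> Q (v + 0 *\<^sub>R 1)"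
      by (auto intro: continuous_on_tendsto_compose[of UNIV Q])
    moreover have "Q (v + inverse (real (Suc m)) *\<^sub>R 1) \<ge> 0" for m
      using nonneg by (intro less_imp_le Q_pos) (simp add: pos_orthant_def add_nonneg_pos)
    ultimately show "0 \<le> Q v"
      by (auto intro: LIMSEQ_le_const)
  qed
  obtain T :: "'n set" where "card T = 3"
    using obtain_subset_with_card_n[OF assms] by metis
  then obtain k l r :: 'n where distinct: "k \<noteq> l" "k \<noteq> r" "l \<noteq> r"
    by (auto simp: card_3_iff)
  \<comment> \<open>\<open>z\<close> is the indicator vector of all coordinates except
    \<open>k\<close> and \<open>l\<close>. Thus \<open>x + y\<close> vanishes at \<open>r\<close>,
    \<open>y + z\<close> at \<open>k\<close> and \<open>x + z\<close> at \<open>l\<close>.\<close>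
  define x y z :: "real^'n" where "x = axis k 1" and "y = axis l 1" and "z = 1 - x - y"
  have Q_eq: "Q (x + y + z) = Q (x + y) + Q (y + z) + Q (x + z) - Q x - Q y - Q z"
    by (simp add: Q_def matrix_vector_right_distrib lorentz_form_add3)
  have "Q (x + y) = 0" "Q x = 0" "Q y = 0"
    using distinct by (auto intro!: Q_boundary[of _ r] simp: x_def y_def axis_def)
  moreover have "Q (y + z) = 0" "Q z = 0"
    using distinct by (auto intro!: Q_boundary[of _ k] simp: x_def y_def z_def axis_def)
  moreover have "Q (x + z) = 0"
    using distinct by (auto intro!: Q_boundary[of _ l] simp: x_def y_def z_def axis_def)
  moreover have "x + y + z = 1" by (simp add: z_def)
  ultimately have "Q 1 = 0" using Q_eq by simp
  then show False
    using Q_pos[OF one_in_pos_orthant] by simp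
qed

theorem propositionA1:
  fixes d :: nat
  assumes "d \<ge> 2" and "CARD('n::finite) = d + 1"
  shows "\<exists>(\<Gamma> :: (real^'n^'n) set) (C :: (real^'n) set) (\<Omega> :: (real^'n) set set).
           divides \<Gamma> C \<and> proper_convex_cone C \<and>
           proper_convex_domain \<Omega> \<and> \<Omega> = projectivisation C \<and>
           \<not> proj_ellipse \<Omega>"
proof -
  have "CARD('n) \<ge> 3" using assms by simp
  then show ?thesis
    using divides_diag_lattice proper_convex_cone_pos_orthant proper_convex_domain_pos_orthant
      not_proj_ellipse_pos_orthant by blast
qed

end
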